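(* Let $H\subseteq J$ be a subset of jobs. Let $$\mathcal{X}_H=\{x\in\mathcal{X}^M:\ H \text{ is } x\text{-anchored}\},$$ $$\mathcal{Z}_H=\{z\in\mathcal{X}^M:\ z_j-z_i\ge L^\Delta_{ij}\ \text{ for all } i\in J\cup\{s\},\ j\in H \text{ with } i\prec j\}.$$ Then $\mathcal{Z}_H$ is dominant, in the sense that $\mathcal{Z}_H\subseteq\mathcal{X}_H$, and $\mathcal{X}_H\neq\varnothing$ implies $\mathcal{Z}_H\neq\varnothing$.
   Context: Let $J$ be a finite set of jobs and $\bar J=J\cup\{s,t\}$ with dummy jobs $s,t$ (start and end of the project). Let $G=(\bar J,\mathcal{A})$ be a directed acyclic graph with source $s$ and sink $t$; there is an arc $(s,i)$ (resp. $(i,t)$) for every $i\in J$ without predecessor (resp. successor) in $J$. For $q\in\mathbb{R}_+^J$ (with the convention $q_s=0$), $G(q)$ denotes $G$ with length $q_i$ on every arc $(i,j)\in\mathcal{A}$. A schedule of $G(q)$ is a vector $x\in\mathbb{R}_+^{\bar J}$ with $x_s=0$ and $x_j-x_i\ge q_i$ for every arc $(i,j)\in\mathcal{A}$; its makespan is $x_t$. Write $i\prec j$ if $i\ne j$ and there is a directed path from $i$ to $j$ in $G$, and for $i\prec j$ let $L_{G(q)}(i,j)$ be the length of a longest $i$–$j$ path in $G(q)$. Fix nominal processing times $p\in\mathbb{R}_+^J$, a deadline $M\ge 0$, and an uncertainty set $\Delta\subset\mathbb{R}_+^J$, nonempty and such that the following maxima exist: for $i\prec j$, $L^\Delta_{ij}=\max_{\delta\in\Delta}L_{G(p+\delta)}(i,j)$.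 Let $\mathcal{X}^M$ be the set of schedules $x$ of $G(p)$ with $x_t\le M$. Given a schedule $x$ of $G(p)$, a subset $H\subseteq J$ is $x$-anchored if for every $\delta\in\Delta$ there exists a schedule $x^\delta$ of $G(p+\delta)$ such that $x^\delta_i=x_i$ for every $i\in H$. *)

theory Defs
  imports "HOL-Library.FuncSet" "Graph_Theory.Graph_Theory"
begin

(* Finiteness of J is part of pair_digraph, which makes pverts G finite. *)
locale project_network = pair_digraph G
  for G :: "'a pair_pre_digraph" and J :: "'a set" and s t :: 'a +
  assumes verts_eq: "pverts G = J \<union> {s, t}"
    and dummies: "s \<notin> J" "t \<notin> J" "s \<noteq> t"
    and acyclic: "acyclic (parcs G)"
    and source: "(i, s) \<notin> parcs G"
    and sink: "(t, i) \<notin> parcs G"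
    and start_arcs: "\<lbrakk>i \<in> J; \<And>j. j \<in> J \<Longrightarrow> (j, i) \<notin> parcs G\<rbrakk> \<Longrightarrow> (s, i) \<in> parcs G"
    and end_arcs: "\<lbrakk>i \<in> J; \<And>j. j \<in> J \<Longrightarrow> (i, j) \<notin> parcs G\<rbrakk> \<Longrightarrow> (i, t) \<in> parcs G"

text \<open>
  Vectors indexed by a finite set S are functions in S \<open>\<rightarrow>\<^sub>E\<close> UNIV. Processing times are indexed
  by the jobs only; the convention that q is 0 at s is built into the arc lengths, and no arc
  leaves t.
\<close>

definition arc_length :: "'a \<Rightarrow> ('a \<Rightarrow> real) \<Rightarrow> 'a \<times> 'a \<Rightarrow> real" where
  "arc_length s q e = (if fst e = s then 0 else q (fst e))"

definition schedules :: "'a pair_pre_digraph \<Rightarrow> 'a \<Rightarrow> ('a \<Rightarrow> real) \<Rightarrow> ('a \<Rightarrow> real) set" where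
  "schedules G s q =
     {x \<in> pverts G \<rightarrow>\<^sub>E {0..}. x s = 0 \<and> (\<forall>(i, j)\<in>parcs G. x j - x i \<ge> arc_length s q (i, j))}"

definition precedes :: "'a pair_pre_digraph \<Rightarrow> 'a \<Rightarrow> 'a \<Rightarrow> bool" where
  "precedes G i j \<longleftrightarrow> i \<noteq> j \<and> (\<exists>es. pre_digraph.apath (with_proj G) i es j)"

text \<open>A finite digraph has finitely many paths, so \<^const>\<open>Max\<close> is a genuine maximum if i precedes j.\<close>

definition longest_path :: "'a pair_pre_digraph \<Rightarrow> 'a \<Rightarrow> ('a \<Rightarrow> real) \<Rightarrow> 'a \<Rightarrow> 'a \<Rightarrow> real" where
  "longest_path G s q i j =
     Max {wf_digraph.awalk_cost (arc_length s q) es | es.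
            pre_digraph.apath (with_proj G) i es j}"

definition perturbed :: "('a \<Rightarrow> real) \<Rightarrow> ('a \<Rightarrow> real) \<Rightarrow> 'a \<Rightarrow> real" where
  "perturbed p \<delta> = (\<lambda>i. p i + \<delta> i)"

definition worst_longest_path ::
  "'a pair_pre_digraph \<Rightarrow> 'a \<Rightarrow> ('a \<Rightarrow> real) \<Rightarrow> ('a \<Rightarrow> real) set \<Rightarrow> 'a \<Rightarrow> 'a \<Rightarrow> real" where
  "worst_longest_path G s p \<Delta> i j =
     (GREATEST l. \<exists>\<delta>\<in>\<Delta>. l = longest_path G s (perturbed p \<delta>) i j)"

definition deadline_schedules ::
  "'a pair_pre_digraph \<Rightarrow> 'a \<Rightarrow> 'a \<Rightarrow> ('a \<Rightarrow> real) \<Rightarrow> real \<Rightarrow> ('a \<Rightarrow> real) set" where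
  "deadline_schedules G s t p M = {x \<in> schedules G s p. x t \<le> M}"

definition anchored ::
  "'a pair_pre_digraph \<Rightarrow> 'a \<Rightarrow> ('a \<Rightarrow> real) \<Rightarrow> ('a \<Rightarrow> real) set \<Rightarrow> ('a \<Rightarrow> real) \<Rightarrow> 'a set \<Rightarrow> bool" where
  "anchored G s p \<Delta> x H \<longleftrightarrow>
     (\<forall>\<delta>\<in>\<Delta>. \<exists>y\<in>schedules G s (perturbed p \<delta>). \<forall>i\<in>H. y i = x i)"

definition X_set ::
  "'a pair_pre_digraph \<Rightarrow> 'a \<Rightarrow> 'a \<Rightarrow> ('a \<Rightarrow> real) \<Rightarrow> real \<Rightarrow> ('a \<Rightarrow> real) set \<Rightarrow> 'a set
     \<Rightarrow> ('a \<Rightarrow> real) set" where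
  "X_set G s t p M \<Delta> H = {x \<in> deadline_schedules G s t p M. anchored G s p \<Delta> x H}"

definition Z_set ::
  "'a pair_pre_digraph \<Rightarrow> 'a set \<Rightarrow> 'a \<Rightarrow> 'a \<Rightarrow> ('a \<Rightarrow> real) \<Rightarrow> real \<Rightarrow> ('a \<Rightarrow> real) set \<Rightarrow> 'a set
     \<Rightarrow> ('a \<Rightarrow> real) set" where
  "Z_set G J s t p M \<Delta> H =
     {z \<in> deadline_schedules G s t p M.
        \<forall>i\<in>J \<union> {s}. \<forall>j\<in>H. precedes G i j \<longrightarrow> z j - z i \<ge> worst_longest_path G s p \<Delta> i j}"

end

theory Submission
  imports Defs
begin

text \<open>
  Both inclusions come from one construction. Given arbitrary values w on the vertices, read as
  release dates, let \<open>earliest_from s q w\<close> assign to each vertex k the largest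
  \<open>w i + (length of a path from i to k)\<close>. If w is nonnegative and \<open>w s = 0\<close>, this is the least
  schedule of G(q) that lies above w (\<open>earliest_from_schedule\<close>, \<open>earliest_from_ge\<close>,
  \<open>earliest_from_le_schedule\<close>).

  For \<open>Z_set \<subseteq> X_set\<close>, take z in \<open>Z_set\<close> and a perturbation \<open>\<delta>\<close>, and compute the least schedule
  of G(p + \<open>\<delta>\<close>) above z itself. At a job j of H it still equals z, because the defining
  inequalities of \<open>Z_set\<close> say that no path ending in j, under any perturbation, pushes j beyond
  \<open>z j\<close>.

  For nonemptiness, take x in \<open>X_set\<close> and let z be the least schedule of G(p) above the vector
  that equals x on H and is 0 elsewhere. Since x is a competitor, \<open>z \<le> x\<close>, so z meets the deadline
  and agrees with x on H. For j in H and i preceding j, choose \<open>\<delta>\<close> attaining the worst longest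
  path from i to j, and let y be a schedule of G(p + \<open>\<delta>\<close>) agreeing with x on H. As \<open>\<delta>\<close> is
  nonnegative, y is also a schedule of G(p), hence a competitor, so \<open>z i \<le> y i\<close>, while
  \<open>z j = x j = y j\<close>. Thus \<open>z j - z i \<ge> y j - y i\<close>, which is at least the longest path length.
\<close>

section \<open>Path lengths as lower bounds on schedules\<close>

lemma worst_longest_path_eqI:
  assumes "\<delta> \<in> \<Delta>"
    and "\<And>\<delta>'. \<delta>' \<in> \<Delta> \<Longrightarrow>
      longest_path G s (perturbed p \<delta>') i j \<le> longest_path G s (perturbed p \<delta>) i j"
  shows "worst_longest_path G s p \<Delta> i j = longest_path G s (perturbed p \<delta>) i j"
  unfolding worst_longest_path_def using assms by (intro Greatest_equality) auto

context pair_digraph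
begin

lemma finite_apath_image: "finite {f i es | i es. apath i es k}"
proof -
  have "{f i es | i es. apath i es k} \<subseteq> (\<lambda>(i, es, k). f i es) ` {(i, es, k). apath i es k}"
    by force
  then show ?thesis
    using apaths_finite_triple finite_surj by blast
qed

lemma apath_loop_iff: "apath i es i \<longleftrightarrow> es = [] \<and> i \<in> pverts G"
proof (cases es)
  case Nil
  then show ?thesis by (simp add: apath_Nil_iff)
next
  case (Cons e ds)
  have "i \<in> set (awalk_verts (snd e) ds)" if "awalk (snd e) ds i"
    using that by (metis awalkE last_in_set awalk_verts_non_Nil)
  then show ?thesis
    using Cons by (auto simp: apath_def awalk_Cons_iff)
qed

lemma awalk_cost_le_longest_path:
  assumes "apath i es j"
  shows "awalk_cost (arc_length s q) es \<le> longest_path G s q i j"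
  unfolding longest_path_def using assms apaths_finite
  by (intro Max_ge) auto

lemma longest_path_attained:
  assumes "precedes G i j"
  obtains es where "apath i es j" "longest_path G s q i j = awalk_cost (arc_length s q) es"
proof -
  let ?C = "{awalk_cost (arc_length s q) es | es. apath i es j}"
  have "finite ?C" "?C \<noteq> {}"
    using apaths_finite assms by (auto simp: precedes_def)
  then have "Max ?C \<in> ?C"
    by (rule Max_in)
  then show ?thesis
    using that unfolding longest_path_def by blast
qed

text \<open>Summing the precedence constraints along a walk telescopes.\<close>

lemma schedule_separates_awalk:
  assumes "y \<in> schedules G s q" "awalk i es j"
  shows "y i + awalk_cost (arc_length s q) es \<le> y j"
  using assms(2)
proof (induction es arbitrary: i)
  case Nil
  then show ?case by (simp add: awalk_Nil_iff)
next
  case (Cons e es)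
  obtain k where e: "e = (i, k)" "(i, k) \<in> parcs G" "awalk k es j"
    using Cons.prems by (cases e) (auto simp: awalk_Cons_iff)
  have "arc_length s q (i, k) \<le> y k - y i"
    using assms(1) e(2) by (auto simp: schedules_def)
  with Cons.IH[OF e(3)] e(1) show ?case by simp
qed

lemma schedule_separates_longest_path:
  assumes "y \<in> schedules G s q" "precedes G i j"
  shows "longest_path G s q i j \<le> y j - y i"
proof -
  obtain es where "apath i es j" "longest_path G s q i j = awalk_cost (arc_length s q) es"
    using longest_path_attained[OF assms(2)] .
  then show ?thesis
    using schedule_separates_awalk[OF assms(1), of i es j] by (simp add: apath_def)
qed

section \<open>The least schedule above given release dates\<close>

text \<open>
  The trivial path from k to itself is among those maximised over, so the set is never empty on
  a vertex and the value at k is at least \<open>w k\<close>. Outside the graph the value is \<open>undefined\<close>, as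
  membership in \<^const>\<open>schedules\<close> requires.
\<close>

definition earliest_from :: "'a \<Rightarrow> ('a \<Rightarrow> real) \<Rightarrow> ('a \<Rightarrow> real) \<Rightarrow> 'a \<Rightarrow> real" where
  "earliest_from s q w =
     (\<lambda>k\<in>pverts G. Max {w i + awalk_cost (arc_length s q) es | i es. apath i es k})"

lemma earliest_from_ge_apath:
  assumes "apath i es k"
  shows "w i + awalk_cost (arc_length s q) es \<le> earliest_from s q w k"
proof -
  have "k \<in> pverts G"
    using assms by (auto simp: apath_def dest: awalk_last_in_verts)
  then show ?thesis
    using assms finite_apath_image by (auto simp: earliest_from_def intro!: Max_ge)
qed

lemma earliest_from_ge:
  assumes "k \<in> pverts G"
  shows "w k \<le> earliest_from s q w k"
  using earliest_from_ge_apath[of k "[]" k] assms by (simp add: apath_Nil_iff)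

lemma earliest_from_attained:
  assumes "k \<in> pverts G"
  obtains i es where "apath i es k"
    "earliest_from s q w k = w i + awalk_cost (arc_length s q) es"
proof -
  let ?C = "{w i + awalk_cost (arc_length s q) es | i es. apath i es k}"
  have "apath k [] k"
    using assms by (simp add: apath_Nil_iff)
  then have "?C \<noteq> {}" by blast
  then have "Max ?C \<in> ?C"
    by (intro Max_in finite_apath_image)
  then show ?thesis
    using that assms unfolding earliest_from_def by auto
qed

lemma earliest_from_le_schedule:
  assumes "y \<in> schedules G s q" "\<And>i. i \<in> pverts G \<Longrightarrow> w i \<le> y i" "k \<in> pverts G"
  shows "earliest_from s q w k \<le> y k"
proof -
  obtain i es where path: "apath i es k"
    and eq: "earliest_from s q w k = w i + awalk_cost (arc_length s q) es"
    using earliest_from_attained[OF assms(3)] .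
  from path have "awalk i es k" "i \<in> pverts G"
    by (auto simp: apath_def awalk_def)
  with eq show ?thesis
    using schedule_separates_awalk[OF assms(1), of i es k] assms(2)[of i] by simp
qed

end

context project_network
begin

text \<open>
  In an acyclic graph the head of an arc cannot already lie on a path to its tail: the end of
  that path together with the arc would form a cycle.
\<close>

lemma apath_snoc:
  assumes "apath i es j" "(j, k) \<in> parcs G"
  shows "apath i (es @ [(j, k)]) k"
proof -
  have walk: "awalk i es j" and distinct: "distinct (awalk_verts i es)"
    using assms(1) by (auto simp: apath_def)
  have arc: "awalk j [(j, k)] k"
    using arc_implies_awalk[of "(j, k)"] assms(2) by simp
  have "k \<notin> set (awalk_verts i es)"
  proof
    assume "k \<in> set (awalk_verts i es)"
    then obtain ds where "awalk k ds j"
      using walk by (metis awalk_decomp)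
    then have "awalk k (ds @ [(j, k)]) k"
      using arc by (rule awalk_appendI)
    then have "(k, k) \<in> (parcs G)\<^sup>+"
      using reachable1_awalkI[of k "ds @ [(j, k)]" k] by simp
    then show False
      using acyclic by (auto simp: acyclic_def)
  qed
  moreover have longer: "awalk i (es @ [(j, k)]) k"
    using walk arc by (rule awalk_appendI)
  moreover have "awalk_verts i (es @ [(j, k)]) = awalk_verts i es @ [k]"
    using awalk_verts_append[OF longer] by simp
  ultimately show ?thesis
    using distinct by (simp add: apath_def del: awalk_append_iff)
qed

lemma apath_to_source:
  assumes "apath i es s"
  shows "i = s \<and> es = []"
proof (cases es rule: rev_cases)
  case Nil
  then show ?thesis using assms by (simp add: apath_Nil_iff)
next
  case (snoc ds e)
  then have "awalk (awlast i ds) [e] s"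
    using assms unfolding apath_def by simp
  then have "e \<in> parcs G" "snd e = s"
    by (auto simp: awalk_Cons_iff awalk_Nil_iff)
  then show ?thesis
    using source by (cases e) auto
qed

lemma earliest_from_schedule:
  assumes "\<And>i. i \<in> pverts G \<Longrightarrow> 0 \<le> w i" "w s = 0"
  shows "earliest_from s q w \<in> schedules G s q"
proof -
  let ?y = "earliest_from s q w"
  have s: "s \<in> pverts G"
    using verts_eq by simp
  have "?y \<in> pverts G \<rightarrow>\<^sub>E {0..}"
  proof
    show "?y k \<in> {0..}" if "k \<in> pverts G" for k
      using assms(1)[OF that] earliest_from_ge[OF that, of w s q] by simp
    show "?y k = undefined" if "k \<notin> pverts G" for k
      using that by (simp add: earliest_from_def)
  qed
  moreover have "?y s = 0"
  proof -
    obtain i es where "apath i es s" "?y s = w i + awalk_cost (arc_length s q) es"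
      using earliest_from_attained[OF s] .
    then show ?thesis
      using apath_to_source assms(2) by fastforce
  qed
  moreover have "arc_length s q (j, k) \<le> ?y k - ?y j" if arc: "(j, k) \<in> parcs G" for j k
  proof -
    have "j \<in> pverts G"
      using arc arc_fst_in_verts by fastforce
    then obtain i es where path: "apath i es j"
      and eq: "?y j = w i + awalk_cost (arc_length s q) es"
      by (rule earliest_from_attained)
    show ?thesis
      using earliest_from_ge_apath[OF apath_snoc[OF path arc], of w s q] eq by simp
  qed
  ultimately show ?thesis
    by (auto simp: schedules_def)
qed

lemma schedules_perturbed_subset:
  assumes "\<delta> \<in> J \<rightarrow>\<^sub>E {0..}"
  shows "schedules G s (perturbed p \<delta>) \<subseteq> schedules G s p"
proof -
  have "arc_length s p (i, j) \<le> arc_length s (perturbed p \<delta>) (i, j)" if "(i, j) \<in> parcs G" for i j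
  proof -
    have "i \<in> J \<union> {s}"
      using that sink verts_eq arc_fst_in_verts[OF that] by auto
    then show ?thesis
      using assms by (auto simp: arc_length_def perturbed_def)
  qed
  then show ?thesis
    by (fastforce simp: schedules_def)
qed

section \<open>Dominance\<close>

text \<open>
  Rescheduling z as little as possible under a perturbation leaves every job of H in place.
\<close>

lemma Z_set_subset_X_set:
  assumes max_exists: "\<And>i j. precedes G i j \<Longrightarrow>
      \<exists>\<delta>\<in>\<Delta>. \<forall>\<delta>'\<in>\<Delta>. longest_path G s (perturbed p \<delta>') i j \<le> longest_path G s (perturbed p \<delta>) i j"
    and H: "H \<subseteq> J"
  shows "Z_set G J s t p M \<Delta> H \<subseteq> X_set G s t p M \<Delta> H"
proof
  fix z assume z: "z \<in> Z_set G J s t p M \<Delta> H"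
  then have z_deadline: "z \<in> deadline_schedules G s t p M"
    by (simp add: Z_set_def)
  then have z_nonneg: "\<And>i. i \<in> pverts G \<Longrightarrow> 0 \<le> z i" and z_s: "z s = 0"
    by (auto simp: deadline_schedules_def schedules_def)
  have "\<exists>y\<in>schedules G s (perturbed p \<delta>). \<forall>j\<in>H. y j = z j" if \<delta>: "\<delta> \<in> \<Delta>" for \<delta>
  proof (intro bexI ballI)
    let ?q = "perturbed p \<delta>"
    let ?y = "earliest_from s ?q z"
    show "?y \<in> schedules G s ?q"
      using z_nonneg z_s by (rule earliest_from_schedule)
    fix j assume j: "j \<in> H"
    then have j_vert: "j \<in> pverts G"
      using H verts_eq by blast
    obtain i es where path: "apath i es j"
      and eq: "?y j = z i + awalk_cost (arc_length s ?q) es"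
      using earliest_from_attained[OF j_vert] .
    have "?y j \<le> z j"
    proof (cases "i = j")
      case True
      then have "es = []"
        using path by (simp add: apath_loop_iff)
      then show ?thesis using True eq by simp
    next
      case False
      then have prec: "precedes G i j"
        using path by (auto simp: precedes_def)
      \<comment> \<open>The sink has no outgoing arc, so \<open>i\<close> is one of the vertices constrained by \<open>Z_set\<close>.\<close>
      have "i \<noteq> t"
      proof
        assume "i = t"
        with path False show False
          using sink by (cases es) (auto simp: apath_def awalk_Cons_iff awalk_Nil_iff)
      qed
      then have "i \<in> J \<union> {s}"
        using path verts_eq by (auto simp: apath_def awalk_def)
      then have "worst_longest_path G s p \<Delta> i j \<le> z j - z i"
        using z j prec by (auto simp: Z_set_def)
      moreover obtain \<delta>\<^sub>0 where "\<delta>\<^sub>0 \<in> \<Delta>" and worst: "\<And>\<delta>'. \<delta>' \<in> \<Delta> \<Longrightarrow>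
          longest_path G s (perturbed p \<delta>') i j \<le> longest_path G s (perturbed p \<delta>\<^sub>0) i j"
        using max_exists[OF prec] by blast
      ultimately have "longest_path G s ?q i j \<le> z j - z i"
        using worst[OF \<delta>] by (simp add: worst_longest_path_eqI)
      then show ?thesis
        using awalk_cost_le_longest_path[OF path, of s ?q] eq by simp
    qed
    then show "?y j = z j"
      using earliest_from_ge[OF j_vert, of z s ?q] by simp
  qed
  then show "z \<in> X_set G s t p M \<Delta> H"
    using z_deadline by (auto simp: X_set_def anchored_def)
qed

text \<open>
  Starting every job outside H as early as the anchored jobs permit leaves the most room before
  each job of H.
\<close>

lemma Z_set_nonempty:
  assumes nonneg: "\<Delta> \<subseteq> J \<rightarrow>\<^sub>E {0..}"
    and max_exists: "\<And>i j. precedes G i j \<Longrightarrow>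
      \<exists>\<delta>\<in>\<Delta>. \<forall>\<delta>'\<in>\<Delta>. longest_path G s (perturbed p \<delta>') i j \<le> longest_path G s (perturbed p \<delta>) i j"
    and H: "H \<subseteq> J"
    and x: "x \<in> X_set G s t p M \<Delta> H"
  shows "Z_set G J s t p M \<Delta> H \<noteq> {}"
proof -
  define w where "w i = (if i \<in> H then x i else 0)" for i
  define z where "z = earliest_from s p w"
  have x_sched: "x \<in> schedules G s p" and x_t: "x t \<le> M" and x_anchored: "anchored G s p \<Delta> x H"
    using x by (auto simp: X_set_def deadline_schedules_def)
  have x_nonneg: "\<And>i. i \<in> pverts G \<Longrightarrow> 0 \<le> x i"
    using x_sched by (auto simp: schedules_def)
  have "z \<in> schedules G s p"
    unfolding z_def
  proof (rule earliest_from_schedule)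
    show "0 \<le> w i" if "i \<in> pverts G" for i
      using x_nonneg[OF that] by (simp add: w_def)
    show "w s = 0"
      using H dummies(1) by (auto simp: w_def)
  qed
  have z_le: "z k \<le> y k"
    if "y \<in> schedules G s p" "\<And>i. i \<in> H \<Longrightarrow> y i = x i" "k \<in> pverts G" for y k
    unfolding z_def
  proof (rule earliest_from_le_schedule[OF that(1) _ that(3)])
    show "w i \<le> y i" if "i \<in> pverts G" for i
      using that \<open>y \<in> schedules G s p\<close> \<open>\<And>i. i \<in> H \<Longrightarrow> y i = x i\<close>
      by (auto simp: w_def schedules_def)
  qed
  have z_H: "z j = x j" if "j \<in> H" for j
  proof -
    have j_vert: "j \<in> pverts G"
      using that H verts_eq by blast
    have "x j \<le> z j"
      using earliest_from_ge[OF j_vert, of w s p] that by (simp add: z_def w_def)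
    with z_le[OF x_sched refl j_vert] show ?thesis by simp
  qed
  have "z t \<le> M"
    using z_le[OF x_sched refl, of t] x_t verts_eq by simp
  moreover have "worst_longest_path G s p \<Delta> i j \<le> z j - z i"
    if i: "i \<in> J \<union> {s}" and j: "j \<in> H" and prec: "precedes G i j" for i j
  proof -
    obtain \<delta> where \<delta>: "\<delta> \<in> \<Delta>" and worst: "\<And>\<delta>'. \<delta>' \<in> \<Delta> \<Longrightarrow>
        longest_path G s (perturbed p \<delta>') i j \<le> longest_path G s (perturbed p \<delta>) i j"
      using max_exists[OF prec] by blast
    obtain y where y: "y \<in> schedules G s (perturbed p \<delta>)" "\<And>i. i \<in> H \<Longrightarrow> y i = x i"
      using x_anchored \<delta> by (auto simp: anchored_def)
    have "y \<in> schedules G s p"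
      using y(1) \<delta> nonneg schedules_perturbed_subset by blast
    then have "z i \<le> y i"
      using y(2) i verts_eq by (intro z_le) auto
    moreover have "z j = y j"
      using z_H[OF j] y(2)[OF j] by simp
    moreover have "longest_path G s (perturbed p \<delta>) i j \<le> y j - y i"
      using y(1) prec by (rule schedule_separates_longest_path)
    ultimately show ?thesis
      using worst_longest_path_eqI[OF \<delta> worst] by simp
  qed
  ultimately have "z \<in> Z_set G J s t p M \<Delta> H"
    using \<open>z \<in> schedules G s p\<close> by (simp add: Z_set_def deadline_schedules_def)
  then show ?thesis by blast
qed

end

theorem theorem1:
  fixes G :: "'a pair_pre_digraph" and J H :: "'a set" and s t :: 'a
    and p :: "'a \<Rightarrow> real" and M :: real and \<Delta> :: "('a \<Rightarrow> real) set"
  assumes "project_network G J s t"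
    and "p \<in> J \<rightarrow>\<^sub>E {0..}"
    and "M \<ge> 0"
    and "\<Delta> \<subseteq> J \<rightarrow>\<^sub>E {0..}"
    and "\<Delta> \<noteq> {}"
    and "\<And>i j. precedes G i j \<Longrightarrow>
           \<exists>\<delta>\<in>\<Delta>. \<forall>\<delta>'\<in>\<Delta>. longest_path G s (perturbed p \<delta>') i j \<le> longest_path G s (perturbed p \<delta>) i j"
    and "H \<subseteq> J"
  shows "Z_set G J s t p M \<Delta> H \<subseteq> X_set G s t p M \<Delta> H
    \<and> (X_set G s t p M \<Delta> H \<noteq> {} \<longrightarrow> Z_set G J s t p M \<Delta> H \<noteq> {})"
proof -
  interpret project_network G J s t by fact
  show ?thesis
    using Z_set_subset_X_set[OF assms(6,7)] Z_set_nonempty[OF assms(4,6,7)]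
    by blast
qed

end
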